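(* For every quantum type $A_Q$ of $\lambda_Q$, $\sharp[\![A_Q]\!]\simeq[\![A_Q]\!]$, i.e. the unitary types $\sharp[\![A_Q]\!]$ and $[\![A_Q]\!]$ have the same semantics.
   Context: Quantum types of $\lambda_Q$: $A_Q,B_Q::=\mathsf{qbit}\mid A_Q\otimes B_Q$, translated into unitary types by $[\![\mathsf{qbit}]\!]=\sharp(\mathbb U+\mathbb U)$ and $[\![A_Q\otimes B_Q]\!]=\sharp([\![A_Q]\!]\times[\![B_Q]\!])$. Unitary types are interpreted in a linear-algebraic lambda-calculus as sets of closed value distributions (formal $\mathbb C$-combinations of closed pure values $v::=\lambda x.\vec s\mid *\mid(v_1,v_2)\mid\mathtt{inl}(v)\mid\mathtt{inr}(v)$, modulo the weak-vector-space congruence, with canonical forms $\sum_i\alpha_iv_i$ with distinct $v_i$) of norm $1$, where $\|\sum_i\alpha_iv_i\|^2=\sum_i|\alpha_i|^2$ and $\mathcal S$ is the unit sphere: $[\![\mathbb U]\!]=\{*\}$, $[\![A+B]\!]=\{\mathtt{inl}(\vec v):\vec v\in[\![A]\!]\}\cup\{\mathtt{inr}(\vec w):\vec w\in[\![B]\!]\}$, $[\![A\times B]\!]=\{(\vec v,\vec w):\vec v\in[\![A]\!],\vec w\in[\![B]\!]\}$ (pairs extended bilinearly), $[\![\sharp A]\!]=\mathrm{Span}([\![A]\!])\cap\mathcal S$ with $\mathrm{Span}$ the set of finite $\mathbb C$-linear combinations. $A\simeq B$ means $[\![A]\!]=[\![B]\!]$. *)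

theory Defs
  imports Complex_Main
begin

(* Lambda abstractions are kept abstract: their data (bound variable and body
   term distribution) is an arbitrary parameter type 'l. *)
datatype 'l pval = Lam 'l | Star | Pair "'l pval" "'l pval" | Inl "'l pval" | Inr "'l pval"

(* Value distributions: formal C-combinations of pure values, represented by their
   coefficient functions (the canonical form modulo the weak vector space congruence). *)
type_synonym 'l vdist = "'l pval \<Rightarrow> complex"

definition supp :: "'l vdist \<Rightarrow> 'l pval set" where
  "supp d = {v. d v \<noteq> 0}"

definition is_dist :: "'l vdist \<Rightarrow> bool" where
  "is_dist d \<longleftrightarrow> finite (supp d)"

definition inlD :: "'l vdist \<Rightarrow> 'l vdist" where
  "inlD d = (\<lambda>w. case w of Inl a \<Rightarrow> d a | _ \<Rightarrow> 0)"

definition inrD :: "'l vdist \<Rightarrow> 'l vdist" where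
  "inrD d = (\<lambda>w. case w of Inr a \<Rightarrow> d a | _ \<Rightarrow> 0)"

definition pairD :: "'l vdist \<Rightarrow> 'l vdist \<Rightarrow> 'l vdist" where
  "pairD d e = (\<lambda>w. case w of Pair a b \<Rightarrow> d a * e b | _ \<Rightarrow> 0)"

definition pointD :: "'l pval \<Rightarrow> 'l vdist" where
  "pointD v = (\<lambda>w. if w = v then 1 else 0)"

definition normsq :: "'l vdist \<Rightarrow> real" where
  "normsq d = (\<Sum>v\<in>supp d. (cmod (d v))\<^sup>2)"

definition sphere :: "'l vdist set" where
  "sphere = {d. is_dist d \<and> normsq d = 1}"

definition Span :: "'l vdist set \<Rightarrow> 'l vdist set" where
  "Span S = {d. \<exists>F c. finite F \<and> F \<subseteq> S \<and> d = (\<lambda>w. \<Sum>x\<in>F. c x * x w)}"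

(* unitary types (fragment needed: U, +, \<times>, \<sharp>) *)
datatype utype = UU | USum utype utype | UProd utype utype | USharp utype

fun usem :: "utype \<Rightarrow> 'l vdist set" where
  "usem UU = {pointD Star}"
| "usem (USum A B) = {inlD v | v. v \<in> usem A} \<union> {inrD w | w. w \<in> usem B}"
| "usem (UProd A B) = {pairD v w | v w. v \<in> usem A \<and> w \<in> usem B}"
| "usem (USharp A) = Span (usem A) \<inter> sphere"

(* A \<simeq> B means usem A = usem B (stated directly in the theorem) *)

datatype qtype = Qbit | QTensor qtype qtype

fun qtrans :: "qtype \<Rightarrow> utype" where
  "qtrans Qbit = USharp (USum UU UU)"
| "qtrans (QTensor A B) = USharp (UProd (qtrans A) (qtrans B))"

end

theory Submission
  imports Defs
begin

(* Every translated quantum type is of the form \<sharp>B, and \<sharp> is idempotent: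
   since Span (Span S \<inter> sphere) \<subseteq> Span S, a unit vector in the span of unit
   vectors of Span S is already a unit vector of Span S, and conversely every
   element lies in its own span. *)

lemma Span_zero: "(\<lambda>w. 0) \<in> Span S"
  unfolding Span_def by (rule CollectI, rule exI[of _ "{}"]) auto

lemma Span_scale:
  assumes "d \<in> Span S"
  shows "(\<lambda>w. a * d w) \<in> Span S"
proof -
  obtain F c where F: "finite F" "F \<subseteq> S" "d = (\<lambda>w. \<Sum>x\<in>F. c x * x w)"
    using assms unfolding Span_def by blast
  show ?thesis unfolding Span_def
    by (rule CollectI, rule exI[of _ F], rule exI[of _ "\<lambda>x. a * c x"])
       (simp add: F sum_distrib_left mult.assoc)
qed

lemma Span_add:
  assumes "d \<in> Span S" "e \<in> Span S"
  shows "(\<lambda>w. d w + e w) \<in> Span S"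
proof -
  obtain F c G c' where F: "finite F" "F \<subseteq> S" "d = (\<lambda>w. \<Sum>x\<in>F. c x * x w)"
    and G: "finite G" "G \<subseteq> S" "e = (\<lambda>w. \<Sum>x\<in>G. c' x * x w)"
    using assms unfolding Span_def by blast
  define c'' where "c'' x = (if x \<in> F then c x else 0) + (if x \<in> G then c' x else 0)" for x
  have "(\<lambda>w. d w + e w) = (\<lambda>w. \<Sum>x\<in>F \<union> G. c'' x * x w)"
  proof
    fix w
    have "(\<Sum>x\<in>F \<union> G. (if x \<in> F then c x else 0) * x w) = (\<Sum>x\<in>F. c x * x w)"
      by (rule sum.mono_neutral_cong_right) (auto simp: F G)
    moreover have "(\<Sum>x\<in>F \<union> G. (if x \<in> G then c' x else 0) * x w) = (\<Sum>x\<in>G. c' x * x w)"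
      by (rule sum.mono_neutral_cong_right) (auto simp: F G)
    ultimately show "d w + e w = (\<Sum>x\<in>F \<union> G. c'' x * x w)"
      unfolding c''_def distrib_right sum.distrib by (simp add: F G)
  qed
  then show ?thesis unfolding Span_def using F G by blast
qed

lemma Span_lincomb:
  assumes "finite F" "F \<subseteq> Span S"
  shows "(\<lambda>w. \<Sum>x\<in>F. c x * x w) \<in> Span S"
  using assms
proof (induction F rule: finite_induct)
  case empty
  then show ?case using Span_zero by simp
next
  case (insert y F)
  then have "(\<lambda>w. c y * y w) \<in> Span S" "(\<lambda>w. \<Sum>x\<in>F. c x * x w) \<in> Span S"
    by (auto intro: Span_scale)
  then show ?case using insert Span_add[of "\<lambda>w. c y * y w" S] by simp
qed

lemma Span_subset_Span:
  assumes "T \<subseteq> Span S"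
  shows "Span T \<subseteq> Span S"
proof
  fix d assume "d \<in> Span T"
  then obtain F c where "finite F" "F \<subseteq> T" "d = (\<lambda>w. \<Sum>x\<in>F. c x * x w)"
    unfolding Span_def by blast
  then show "d \<in> Span S" using assms Span_lincomb[of F S c] by blast
qed

lemma Span_superset: "S \<subseteq> Span S"
proof
  fix d assume "d \<in> S"
  then show "d \<in> Span S"
    unfolding Span_def by (auto intro!: exI[of _ "{d}"] exI[of _ "\<lambda>_. 1"])
qed

lemma usem_USharp_USharp: "usem (USharp (USharp B)) = usem (USharp B)"
proof -
  have "Span (Span (usem B) \<inter> sphere) \<subseteq> Span (usem B)"
    by (rule Span_subset_Span) blast
  moreover have "Span (usem B) \<inter> sphere \<subseteq> Span (Span (usem B) \<inter> sphere)"
    by (rule Span_superset)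
  ultimately show ?thesis by auto
qed

lemma qtrans_is_USharp: "\<exists>B. qtrans A = USharp B"
  by (cases A) auto

theorem lemma7:
  fixes A :: qtype
  shows "(usem (USharp (qtrans A)) :: 'l vdist set) = usem (qtrans A)"
  using qtrans_is_USharp[of A] usem_USharp_USharp by metis

end
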